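(* Let $\bm Z'=(\bm X_i',f(\bm X_i'))_{i=1}^{n-1}$ represent $n-1$ samples and $\bm Z=(\bm X_i,f(\bm X_i))_{i=1}^n$ represent $n$ samples, where the $\bm X_i$, respectively the $\bm X_i'$, are independent and identically distributed according to $\rho$ on $\Omega$. Then the expected value of the risk functional for $n-1$ nodes equals the expected value of the cross-validation score for $n$ nodes: $$\mathbb E_{\bm Z'}\{\mathcal E(R_h(\bm Z'))\}=\mathbb E_{\bm Z}\{\mathrm{CV}(\bm Z,h)\}.$$
   Context: $(\Omega,\rho)$ is a probability space, $Y\subseteq\mathbb C$ is a set of values with absolute value $|\cdot|$, and $f\colon\Omega\to Y$ is a function. A reconstruction method $R_h$ assigns to a finite list of samples in $\Omega\times Y$ (here lists of length $n-1$) a function $\Omega\to Y$; $h$ is a label for the method/parameter. All functions are tacitly assumed measurable where needed. For $\bm z=(z_1,\dots,z_n)\in(\Omega\times Y)^n$ with nodes $\bm x_1,\dots,\bm x_n$, put $\bm z_{-i}=(z_1,\dots,z_{i-1},z_{i+1},\dots,z_n)$. Risk functional: $\mathcal E(g)=\int_\Omega|g(\bm x)-f(\bm x)|^2\,\mathrm d\rho(\bm x)$ for $g\colon\Omega\to Y$. Leave-one-out cross-validation score: $\mathrm{CV}(\bm z,h)=\frac1n\sum_{i=1}^n|R_h(\bm z_{-i})(\bm x_i)-f(\bm x_i)|^2$. *)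

theory Defs
  imports "HOL-Probability.Probability"
begin

text \<open>Expectations of nonnegative quantities are Lebesgue integrals with values in
  \<open>[0, \<infinity>]\<close>, because neither the risk nor its expectation need be finite.\<close>

definition risk :: "'a measure \<Rightarrow> ('a \<Rightarrow> complex) \<Rightarrow> ('a \<Rightarrow> complex) \<Rightarrow> ennreal" where
  "risk \<rho> f g = (\<integral>\<^sup>+ x. ennreal ((cmod (g x - f x))\<^sup>2) \<partial>\<rho>)"

text \<open>The list indices are \<open>0, \<dots>, n - 1\<close> for what is usually numbered \<open>1, \<dots>, n\<close>.\<close>

definition leave_out :: "nat \<Rightarrow> 'b list \<Rightarrow> 'b list" where
  "leave_out i z = take i z @ drop (Suc i) z"

definition cv_score ::
  "('h \<Rightarrow> ('a \<times> complex) list \<Rightarrow> 'a \<Rightarrow> complex) \<Rightarrow> ('a \<Rightarrow> complex)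
    \<Rightarrow> ('a \<times> complex) list \<Rightarrow> 'h \<Rightarrow> real" where
  "cv_score R f z h =
    1 / real (length z) *
      (\<Sum>i<length z. (cmod (R h (leave_out i z) (fst (z ! i)) - f (fst (z ! i))))\<^sup>2)"

definition samples ::
  "('a \<Rightarrow> complex) \<Rightarrow> (nat \<Rightarrow> 'w \<Rightarrow> 'a) \<Rightarrow> nat \<Rightarrow> 'w \<Rightarrow> ('a \<times> complex) list" where
  "samples f X n \<omega> = map (\<lambda>i. (X i \<omega>, f (X i \<omega>))) [0..<n]"

definition iid :: "'w measure \<Rightarrow> 'a measure \<Rightarrow> nat \<Rightarrow> (nat \<Rightarrow> 'w \<Rightarrow> 'a) \<Rightarrow> bool" where
  "iid M \<rho> n X \<longleftrightarrow>
    prob_space.indep_vars M (\<lambda>_. \<rho>) X {..<n} \<and> (\<forall>i<n. distr M \<rho> (X i) = \<rho>)"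

text \<open>A reconstruction method takes lists of length \<open>m\<close> over \<open>\<Omega> \<times> Y\<close> to functions
  \<open>\<Omega> \<rightarrow> Y\<close>; it is measurable if it is so jointly in the data and the evaluation point.
  Lists of length \<open>m\<close> are read off from the product space \<open>(\<Omega> \<times> Y)\<^sup>m\<close>, and \<open>Y\<close> carries the
  trace of the Borel sets, so that measurability includes the typing by \<open>\<Omega>\<close> and \<open>Y\<close>.\<close>

definition measurable_reconstruction ::
  "'a measure \<Rightarrow> complex set \<Rightarrow> nat \<Rightarrow> (('a \<times> complex) list \<Rightarrow> 'a \<Rightarrow> complex) \<Rightarrow> bool" where
  "measurable_reconstruction \<rho> Y m R \<longleftrightarrow>
    (\<lambda>(z, x). R (map z [0..<m]) x)
      \<in> measurable ((\<Pi>\<^sub>M i\<in>{..<m}. (\<rho> \<Otimes>\<^sub>M restrict_space borel Y)) \<Otimes>\<^sub>M \<rho>)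
                   (restrict_space borel Y)"

end

theory Submission
  imports Defs
begin

text \<open>By Fubini, the expected risk for \<open>m\<close> nodes is the expected squared error at an independent
  additional node distributed according to \<open>\<rho>\<close>. Moving the left-out node to the last position is a
  permutation of the i.i.d. nodes, so each summand of the cross-validation score has exactly this
  expectation.\<close>

lemma iid_random_variable:
  assumes "prob_space M" "iid M \<rho> n X" "i < n"
  shows "X i \<in> measurable M \<rho>"
proof -
  interpret prob_space M by fact
  show ?thesis
    using assms unfolding iid_def indep_vars_def by auto
qed

text \<open>This turns every expectation over an abstract sample space into an integral over a power
  of \<open>\<rho>\<close>: independence makes the joint law the product of the marginal laws, each
  of which is \<open>\<rho>\<close>.\<close>

lemma iid_distr_PiM:
  assumes "prob_space M" "iid M \<rho> n X"
  shows "distr M (\<Pi>\<^sub>M i\<in>{..<n}. \<rho>) (\<lambda>\<omega>. \<lambda>i\<in>{..<n}. X i \<omega>) = (\<Pi>\<^sub>M i\<in>{..<n}. \<rho>)"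
\<comment> \<open>The product characterization of independence used below assumes a nonempty index
  set. The empty case does occur: leaving out the only node of a one-point sample leaves no data.
  Both measures are then the point mass at \<open>\<lambda>_. undefined\<close>.\<close>
proof (cases "n = 0")
  case True
  interpret prob_space M by fact
  have "distr M (\<Pi>\<^sub>M i\<in>{}. \<rho>) (\<lambda>\<omega>. \<lambda>i\<in>{}. X i \<omega>) = (\<Pi>\<^sub>M i\<in>{}. \<rho>)"
  proof (rule measure_eqI)
    fix A assume "A \<in> sets (distr M (\<Pi>\<^sub>M i\<in>{}. \<rho>) (\<lambda>\<omega>. \<lambda>i\<in>{}. X i \<omega>))"
    then have "A = {} \<or> A = {\<lambda>_. undefined}"
      by (auto simp: sets_PiM_empty)
    then show "emeasure (distr M (\<Pi>\<^sub>M i\<in>{}. \<rho>) (\<lambda>\<omega>. \<lambda>i\<in>{}. X i \<omega>)) A = emeasure (\<Pi>\<^sub>M i\<in>{}. \<rho>) A"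
      by (auto simp: emeasure_distr restrict_def emeasure_space_1 sets_PiM_empty)
  qed simp
  with True show ?thesis by simp
next
  case False
  interpret prob_space M by fact
  have "distr M (\<Pi>\<^sub>M i\<in>{..<n}. \<rho>) (\<lambda>\<omega>. \<lambda>i\<in>{..<n}. X i \<omega>) = (\<Pi>\<^sub>M i\<in>{..<n}. distr M \<rho> (X i))"
    using False assms iid_random_variable[OF assms(1,2)]
    by (subst indep_vars_iff_distr_eq_PiM'[symmetric]) (auto simp: iid_def)
  also have "\<dots> = (\<Pi>\<^sub>M i\<in>{..<n}. \<rho>)"
    using assms(2) by (intro PiM_cong) (auto simp: iid_def)
  finally show ?thesis .
qed

lemma (in prob_space) indep_sets_reindex:
  assumes inj: "inj_on \<pi> I" and ind: "indep_sets F (\<pi> ` I)"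
  shows "indep_sets (\<lambda>i. F (\<pi> i)) I"
  unfolding indep_sets_def
proof (intro conjI ballI allI impI)
  show "F (\<pi> i) \<subseteq> events" if "i \<in> I" for i
    using ind that by (auto simp: indep_sets_def)
next
  fix J A assume J: "J \<subseteq> I" "J \<noteq> {}" "finite J" and A: "A \<in> (\<Pi> i\<in>J. F (\<pi> i))"
  have injJ: "inj_on \<pi> J"
    using inj J(1) by (rule inj_on_subset)
  define B where "B = (\<lambda>k. A (the_inv_into J \<pi> k))"
  have B: "B (\<pi> j) = A j" if "j \<in> J" for j
    using that injJ by (simp add: B_def the_inv_into_f_f)
  have "B \<in> Pi (\<pi> ` J) F"
    using A B by auto
  then have "prob (\<Inter>k\<in>\<pi> ` J. B k) = (\<Prod>k\<in>\<pi> ` J. prob (B k))"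
    using ind J unfolding indep_sets_def by (meson finite_imageI image_is_empty image_mono)
  then show "prob (\<Inter>j\<in>J. A j) = (\<Prod>j\<in>J. prob (A j))"
    using injJ B by (simp add: prod.reindex)
qed

lemma iid_permute:
  assumes "prob_space M" "iid M \<rho> n X" "inj_on \<pi> {..<n}" "\<pi> ` {..<n} \<subseteq> {..<n}"
  shows "iid M \<rho> n (\<lambda>i. X (\<pi> i))"
proof -
  interpret prob_space M by fact
  have "indep_vars (\<lambda>_. \<rho>) X (\<pi> ` {..<n})"
    using assms indep_vars_subset unfolding iid_def by blast
  then have "indep_vars (\<lambda>_. \<rho>) (\<lambda>i. X (\<pi> i)) {..<n}"
    unfolding indep_vars_def2 using indep_sets_reindex[OF assms(3)] by auto
  then show ?thesis
    using assms(2,4) unfolding iid_def by auto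
qed

text \<open>The hypothesis on \<open>R\<close> concerns arbitrary data in
  \<open>\<Omega> \<times> Y\<close>, whereas the samples lie on the graph of \<open>f\<close>.
  Composing with the map from node tuples to their data reduces one to the other.\<close>

lemma measurable_square_error:
  assumes f: "f \<in> measurable \<rho> (restrict_space borel Y)"
    and R: "measurable_reconstruction \<rho> Y m R"
  shows "(\<lambda>(y, x). ennreal ((cmod (R (map (\<lambda>i. (y i, f (y i))) [0..<m]) x - f x))\<^sup>2))
    \<in> borel_measurable ((\<Pi>\<^sub>M i\<in>{..<m}. \<rho>) \<Otimes>\<^sub>M \<rho>)"
proof -
  have [measurable]: "f \<in> borel_measurable \<rho>"
    using f by (simp add: measurable_restrict_space2_iff)
  have "(\<lambda>(z, x). R (map z [0..<m]) x) \<in> borel_measurable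
      ((\<Pi>\<^sub>M i\<in>{..<m}. (\<rho> \<Otimes>\<^sub>M restrict_space borel Y)) \<Otimes>\<^sub>M \<rho>)"
    using R by (simp add: measurable_reconstruction_def measurable_restrict_space2_iff)
  \<comment> \<open>Here \<open>f\<close> must be measurable into the trace of the Borel sets on
    \<open>Y\<close>, since its values enter as data.\<close>
  moreover have "(\<lambda>(y, x). (\<lambda>i\<in>{..<m}. (y i, f (y i)), x)) \<in> measurable ((\<Pi>\<^sub>M i\<in>{..<m}. \<rho>) \<Otimes>\<^sub>M \<rho>)
      ((\<Pi>\<^sub>M i\<in>{..<m}. (\<rho> \<Otimes>\<^sub>M restrict_space borel Y)) \<Otimes>\<^sub>M \<rho>)"
  proof -
    note f[measurable]
    show ?thesis by measurable
  qed
  ultimately have "(\<lambda>p. (\<lambda>(z, x). R (map z [0..<m]) x) ((\<lambda>(y, x). (\<lambda>i\<in>{..<m}. (y i, f (y i)), x)) p))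
      \<in> borel_measurable ((\<Pi>\<^sub>M i\<in>{..<m}. \<rho>) \<Otimes>\<^sub>M \<rho>)"
    by (rule measurable_compose[rotated])
  moreover have "map (\<lambda>i\<in>{..<m}. (y i, f (y i))) [0..<m] = map (\<lambda>i. (y i, f (y i))) [0..<m]" for y
    by simp
  ultimately have [measurable]: "(\<lambda>(y, x). R (map (\<lambda>i. (y i, f (y i))) [0..<m]) x)
      \<in> borel_measurable ((\<Pi>\<^sub>M i\<in>{..<m}. \<rho>) \<Otimes>\<^sub>M \<rho>)"
    by (simp only: case_prod_beta' fst_conv snd_conv)
  show ?thesis
    by measurable
qed

text \<open>The expected risk depends only on the joint law of the nodes. The right-hand side is
  free of \<open>M\<close> and \<open>X\<close>, so it can be compared with quantities from another
  probability space.\<close>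

lemma expected_risk_eq_nn_integral_PiM:
  assumes "prob_space \<rho>" "prob_space M" "iid M \<rho> m X"
    and f: "f \<in> measurable \<rho> (restrict_space borel Y)"
    and R: "measurable_reconstruction \<rho> Y m R"
  shows "(\<integral>\<^sup>+ \<omega>. risk \<rho> f (R (samples f X m \<omega>)) \<partial>M) =
    (\<integral>\<^sup>+ y. risk \<rho> f (R (map (\<lambda>i. (y i, f (y i))) [0..<m])) \<partial>(\<Pi>\<^sub>M i\<in>{..<m}. \<rho>))"
proof -
  interpret \<rho>: prob_space \<rho> by fact
  note measurable_square_error[OF f R, measurable] iid_random_variable[OF assms(2,3), measurable]
  let ?X = "\<lambda>\<omega>. \<lambda>i\<in>{..<m}. X i \<omega>"
  have "(\<integral>\<^sup>+ \<omega>. risk \<rho> f (R (samples f X m \<omega>)) \<partial>M) =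
      (\<integral>\<^sup>+ \<omega>. risk \<rho> f (R (map (\<lambda>i. (?X \<omega> i, f (?X \<omega> i))) [0..<m])) \<partial>M)"
    unfolding samples_def by (intro nn_integral_cong arg_cong[of _ _ "\<lambda>z. risk \<rho> f (R z)"]) simp
  also have "\<dots> = (\<integral>\<^sup>+ y. risk \<rho> f (R (map (\<lambda>i. (y i, f (y i))) [0..<m]))
      \<partial>distr M (\<Pi>\<^sub>M i\<in>{..<m}. \<rho>) ?X)"
    unfolding risk_def by (subst nn_integral_distr) (auto intro!: measurable_restrict)
  finally show ?thesis
    by (simp only: iid_distr_PiM[OF assms(2,3)])
qed

text \<open>Under the product law, the node of index \<open>m\<close> is independent of the data,
  which use only smaller indices. Integrating it out first gives the risk.\<close>

lemma expected_error_at_last_node: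
  assumes "prob_space \<rho>" "prob_space M" "iid M \<rho> (Suc m) X"
    and f: "f \<in> measurable \<rho> (restrict_space borel Y)"
    and R: "measurable_reconstruction \<rho> Y m R"
  shows "(\<integral>\<^sup>+ \<omega>. ennreal ((cmod (R (samples f X m \<omega>) (X m \<omega>) - f (X m \<omega>)))\<^sup>2) \<partial>M) =
    (\<integral>\<^sup>+ y. risk \<rho> f (R (map (\<lambda>i. (y i, f (y i))) [0..<m])) \<partial>(\<Pi>\<^sub>M i\<in>{..<m}. \<rho>))"
proof -
  interpret \<rho>: prob_space \<rho> by fact
  interpret product_sigma_finite "\<lambda>_::nat. \<rho>" by unfold_locales
  define F where
    "F y x = ennreal ((cmod (R (map (\<lambda>i. (y i, f (y i))) [0..<m]) x - f x))\<^sup>2)" for y x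
  have F[measurable]: "(\<lambda>(y, x). F y x) \<in> borel_measurable ((\<Pi>\<^sub>M i\<in>{..<m}. \<rho>) \<Otimes>\<^sub>M \<rho>)"
    unfolding F_def by (rule measurable_square_error[OF f R])
  \<comment> \<open>\<open>F\<close> reads only coordinates below \<open>m\<close>, so restricting a
    tuple to them or overwriting coordinate \<open>m\<close> changes nothing.\<close>
  have F_cong: "F y x = F y' x" if "\<And>i. i < m \<Longrightarrow> y i = y' i" for y y' x
    unfolding F_def using that by (intro arg_cong[of _ _ "\<lambda>z. ennreal ((cmod (R z x - f x))\<^sup>2)"]) auto
  let ?X = "\<lambda>\<omega>. \<lambda>i\<in>{..<Suc m}. X i \<omega>"
  \<comment> \<open>Measurability of \<open>F\<close> is known only on the \<open>m\<close>-fold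
    product, so tuples of length \<open>Suc m\<close> are first cut down to it.\<close>
  have "(\<lambda>y. (restrict y {..<m}, y m)) \<in>
      measurable (\<Pi>\<^sub>M i\<in>{..<Suc m}. \<rho>) ((\<Pi>\<^sub>M i\<in>{..<m}. \<rho>) \<Otimes>\<^sub>M \<rho>)"
    by (intro measurable_Pair measurable_restrict_subset measurable_component_singleton) auto
  from measurable_compose[OF this F]
  have "(\<lambda>y. F (restrict y {..<m}) (y m)) \<in> borel_measurable (\<Pi>\<^sub>M i\<in>{..<Suc m}. \<rho>)"
    by simp
  then have meas[measurable]: "(\<lambda>y. F y (y m)) \<in> borel_measurable (\<Pi>\<^sub>M i\<in>{..<Suc m}. \<rho>)"
    by (rule measurable_cong[THEN iffD1, rotated]) (auto intro!: F_cong)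
  have "(\<integral>\<^sup>+ \<omega>. ennreal ((cmod (R (samples f X m \<omega>) (X m \<omega>) - f (X m \<omega>)))\<^sup>2) \<partial>M) =
      (\<integral>\<^sup>+ \<omega>. F (\<lambda>i. X i \<omega>) (X m \<omega>) \<partial>M)"
    by (simp add: F_def samples_def)
  also have "\<dots> = (\<integral>\<^sup>+ \<omega>. F (?X \<omega>) (?X \<omega> m) \<partial>M)"
    by (intro nn_integral_cong) (auto intro!: F_cong)
  also have "\<dots> = (\<integral>\<^sup>+ y. F y (y m) \<partial>distr M (\<Pi>\<^sub>M i\<in>{..<Suc m}. \<rho>) ?X)"
    using iid_random_variable[OF assms(2,3)]
    by (subst nn_integral_distr) (auto intro!: measurable_restrict)
  also have "\<dots> = (\<integral>\<^sup>+ y. F y (y m) \<partial>(\<Pi>\<^sub>M i\<in>insert m {..<m}. \<rho>))"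
    by (simp only: iid_distr_PiM[OF assms(2,3)] lessThan_Suc[symmetric])
  also have "\<dots> = (\<integral>\<^sup>+ y. \<integral>\<^sup>+ x. F (y(m := x)) x \<partial>\<rho> \<partial>(\<Pi>\<^sub>M i\<in>{..<m}. \<rho>))"
    using meas by (subst product_nn_integral_insert) (auto simp: lessThan_Suc)
  also have "\<dots> = (\<integral>\<^sup>+ y. \<integral>\<^sup>+ x. F y x \<partial>\<rho> \<partial>(\<Pi>\<^sub>M i\<in>{..<m}. \<rho>))"
    by (intro nn_integral_cong) (auto intro!: F_cong)
  finally show ?thesis
    unfolding F_def risk_def .
qed

lemma leave_out_samples:
  assumes "i < Suc m"
  shows "leave_out i (samples f X (Suc m) \<omega>) =
    samples f (\<lambda>j. X (if j < i then j else Suc j)) m \<omega>"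
  using assms
  by (intro nth_equalityI) (auto simp: leave_out_def samples_def nth_append min_def simp del: upt_Suc)

lemma expected_error_at_left_out_node:
  assumes "prob_space \<rho>" "prob_space M" "iid M \<rho> (Suc m) X" "i < Suc m"
    and "f \<in> measurable \<rho> (restrict_space borel Y)"
    and "measurable_reconstruction \<rho> Y m R"
  shows "(\<lambda>\<omega>. ennreal ((cmod (R (leave_out i (samples f X (Suc m) \<omega>)) (X i \<omega>) - f (X i \<omega>)))\<^sup>2))
      \<in> borel_measurable M" (is ?meas)
    and "(\<integral>\<^sup>+ \<omega>. ennreal ((cmod (R (leave_out i (samples f X (Suc m) \<omega>)) (X i \<omega>) - f (X i \<omega>)))\<^sup>2) \<partial>M) =
      (\<integral>\<^sup>+ y. risk \<rho> f (R (map (\<lambda>i. (y i, f (y i))) [0..<m])) \<partial>(\<Pi>\<^sub>M i\<in>{..<m}. \<rho>))" (is ?int)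
proof -
  \<comment> \<open>\<open>\<pi>\<close> is the cycle that moves \<open>i\<close> to the last
    position and keeps the order of the other indices; for \<open>i = m\<close> it is the identity
    on \<open>{..<Suc m}\<close>.\<close>
  define \<pi> where "\<pi> j = (if j = m then i else if j < i then j else Suc j)" for j
  have iid: "iid M \<rho> (Suc m) (\<lambda>j. X (\<pi> j))"
    using assms(4) by (intro iid_permute[OF assms(2,3)])
      (auto simp: \<pi>_def inj_on_def split: if_splits)
  have X\<pi>: "X (\<pi> j) \<in> measurable M \<rho>" if "j < Suc m" for j
    using iid_random_variable[OF assms(2) iid that] .
  have eq: "leave_out i (samples f X (Suc m) \<omega>) = samples f (\<lambda>j. X (\<pi> j)) m \<omega>" for \<omega>
    unfolding leave_out_samples[OF assms(4)] by (auto simp: samples_def \<pi>_def)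
  have last: "X i = X (\<pi> m)"
    by (simp add: \<pi>_def)
  show ?int
    unfolding eq last by (rule expected_error_at_last_node[OF assms(1,2) iid assms(5,6)])
  have "(\<lambda>\<omega>. (\<lambda>j\<in>{..<m}. X (\<pi> j) \<omega>, X (\<pi> m) \<omega>)) \<in> measurable M ((\<Pi>\<^sub>M j\<in>{..<m}. \<rho>) \<Otimes>\<^sub>M \<rho>)"
    by (intro measurable_Pair measurable_restrict X\<pi>) auto
  from measurable_compose[OF this measurable_square_error[OF assms(5,6)]]
  have "(\<lambda>\<omega>. ennreal ((cmod (R (map (\<lambda>j. ((\<lambda>j\<in>{..<m}. X (\<pi> j) \<omega>) j,
      f ((\<lambda>j\<in>{..<m}. X (\<pi> j) \<omega>) j))) [0..<m]) (X (\<pi> m) \<omega>) - f (X (\<pi> m) \<omega>)))\<^sup>2))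
    \<in> borel_measurable M"
    by (simp only: case_prod_conv)
  moreover have "map (\<lambda>j. ((\<lambda>j\<in>{..<m}. X (\<pi> j) \<omega>) j, f ((\<lambda>j\<in>{..<m}. X (\<pi> j) \<omega>) j))) [0..<m] =
      samples f (\<lambda>j. X (\<pi> j)) m \<omega>" for \<omega>
    by (simp add: samples_def)
  ultimately show ?meas
    unfolding eq last by (simp only:)
qed

theorem lemma3p7:
  fixes \<rho> :: "'a measure" and M :: "'w measure" and M' :: "'v measure"
    and Y :: "complex set" and f :: "'a \<Rightarrow> complex"
    and R :: "'h \<Rightarrow> ('a \<times> complex) list \<Rightarrow> 'a \<Rightarrow> complex" and h :: 'h
    and X :: "nat \<Rightarrow> 'w \<Rightarrow> 'a" and X' :: "nat \<Rightarrow> 'v \<Rightarrow> 'a" and n :: nat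
  assumes "n \<ge> 1"
    and "prob_space \<rho>" and "prob_space M" and "prob_space M'"
    and "f \<in> measurable \<rho> (restrict_space borel Y)"
    and "measurable_reconstruction \<rho> Y (n - 1) (R h)"
    and "iid M' \<rho> (n - 1) X'"
    and "iid M \<rho> n X"
  shows "(\<integral>\<^sup>+ \<omega>. risk \<rho> f (R h (samples f X' (n - 1) \<omega>)) \<partial>M')
       = (\<integral>\<^sup>+ \<omega>. ennreal (cv_score R f (samples f X n \<omega>) h) \<partial>M)"
proof -
  define m where "m = n - 1"
  have n: "n = Suc m"
    using assms(1) by (simp add: m_def)
  have R: "measurable_reconstruction \<rho> Y m (R h)" and X': "iid M' \<rho> m X'" and X: "iid M \<rho> (Suc m) X"
    using assms by (simp_all add: n)
  \<comment> \<open>\<open>I\<close> is the common value of both sides, written over the product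
    space because \<open>M\<close> and \<open>M'\<close> are unrelated.\<close>
  define I where
    "I = (\<integral>\<^sup>+ y. risk \<rho> f (R h (map (\<lambda>i. (y i, f (y i))) [0..<m])) \<partial>(\<Pi>\<^sub>M i\<in>{..<m}. \<rho>))"
  define E where "E i \<omega> =
    ennreal ((cmod (R h (leave_out i (samples f X (Suc m) \<omega>)) (X i \<omega>) - f (X i \<omega>)))\<^sup>2)" for i \<omega>
  have E: "E i \<in> borel_measurable M" "(\<integral>\<^sup>+ \<omega>. E i \<omega> \<partial>M) = I" if "i < Suc m" for i
    unfolding E_def I_def
    using expected_error_at_left_out_node[OF assms(2,3) X that assms(5) R] by simp_all
  have "ennreal (cv_score R f (samples f X (Suc m) \<omega>) h) =
      ennreal (1 / real (Suc m)) * (\<Sum>i<Suc m. E i \<omega>)" for \<omega>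
  proof -
    have "length (samples f X (Suc m) \<omega>) = Suc m"
      by (simp add: samples_def)
    moreover have "fst (samples f X (Suc m) \<omega> ! i) = X i \<omega>" if "i < Suc m" for i
      using that by (simp add: samples_def del: upt_Suc)
    ultimately show ?thesis
      unfolding cv_score_def E_def
      by (subst sum_ennreal) (auto simp: ennreal_mult[symmetric] sum_nonneg
        simp del: sum.lessThan_Suc of_nat_Suc cong: sum.cong_simp)
  qed
  then have "(\<integral>\<^sup>+ \<omega>. ennreal (cv_score R f (samples f X (Suc m) \<omega>) h) \<partial>M) =
      ennreal (1 / real (Suc m)) * (\<Sum>i<Suc m. \<integral>\<^sup>+ \<omega>. E i \<omega> \<partial>M)"
    using E(1) by (simp only:, subst nn_integral_cmult)
      (auto intro!: borel_measurable_sum nn_integral_sum arg_cong2[of _ _ _ _ "(*)"]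
        simp del: sum.lessThan_Suc of_nat_Suc)
  also have "\<dots> = ennreal (1 / real (Suc m)) * (of_nat (Suc m) * I)"
    using E(2) by (simp del: sum.lessThan_Suc of_nat_Suc)
  \<comment> \<open>The two finite factors are multiplied together first, so the cancellation also
    covers an infinite \<open>I\<close>.\<close>
  also have "\<dots> = I"
    by (simp add: mult.assoc[symmetric] ennreal_of_nat_eq_real_of_nat ennreal_mult[symmetric] del: of_nat_Suc)
  also have "\<dots> = (\<integral>\<^sup>+ \<omega>. risk \<rho> f (R h (samples f X' m \<omega>)) \<partial>M')"
    unfolding I_def
    by (rule expected_risk_eq_nn_integral_PiM[OF assms(2,4) X' assms(5) R, symmetric])
  finally show ?thesis
    by (simp add: n)
qed

end
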